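(* Let $\sigma=\sigma_1+i\sigma_2\in\mathbb{C}$ with $\sigma_2>0$. Then $$\mathcal{H}_{\mathcal{P}_{0,\sigma}}=\overline{\left\{\phi\,e^{-i\lambda_{0,\sigma}}\otimes\sqrt{\Omega_{0,\sigma}}\ \middle|\ \phi\in C^\infty(\mathcal{P}_{0,\sigma}),\ \int_{G\times i\mathfrak{t}}|\phi|^2e^{-\kappa_{0,\sigma}}\,|\sqrt{\Omega_{0,\sigma}}|^2<\infty\right\}},$$ where $\lambda_{0,\sigma}(x,y)=-\sigma f(y)$, $\kappa_{0,\sigma}=2\sigma_2f$, and $C^\infty(\mathcal{P}_{0,\sigma})$ is the space of $\mathcal{P}_{0,\sigma}$-polarized smooth functions on $T^*G$.
   Context: $G$ is a compact connected Lie group of dimension $n$ and rank $r$ with Lie algebra $\mathfrak{g}$ carrying an $\mathrm{Ad}$-invariant inner product $\langle\cdot,\cdot\rangle$; $T\subset G$ is a maximal torus with Lie algebra $\mathfrak{t}$. Via left translation and the inner product, $T^*G\cong G\times\mathfrak{g}$ and $T_{(x,y)}(T^*G)\cong\mathfrak{g}\oplus\mathfrak{g}$, where $(U,V)$ is the velocity at $s=0$ of $s\mapsto(xe^{sU},y+sV)$. The canonical one-form is $\theta_{(x,y)}(U,V)=\langle y,U\rangle$. $F:\mathfrak{g}\to\mathfrak{g}$ is a real linear self-adjoint map with image in $\mathfrak{t}$, $F|_{\mathfrak{t}^\perp}=0$ and $F|_{\mathfrak{t}}$ positive definite; $\det F$ means $\det F|_{\mathfrak{t}}$; $f(x,y)=f(y)=\frac12\langle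 y,Fy\rangle$. The mixed polarization is $\mathcal{P}_{0,\sigma}|_{(x,y)}=\{(-\bar\sigma FA,A)\mid A\in\mathfrak{g}_{\mathbb{C}}\}$. A smooth complex function $\phi$ on $T^*G$ is $\mathcal{P}_{0,\sigma}$-polarized if it is annihilated by all vectors in $\overline{\mathcal{P}_{0,\sigma}}$ (in particular it does not depend on the $\mathfrak{t}^\perp$-component of $y$). Half-forms: let $T_1,\dots,T_n$ be an orthonormal basis of $\mathfrak{g}$ with $T_1,\dots,T_r$ a basis of $\mathfrak{t}$, with associated linear coordinates $y^j$ on $\mathfrak{g}$ and dual left-invariant one-forms $w^j$. Put $\Omega_{0,\sigma}=dz^1_\sigma\wedge\cdots\wedge dz^r_\sigma\wedge w^{r+1}\wedge\cdots\wedge w^n$, $dz^j_\sigma=w^j+\sigma\sum_{k=1}^rF_{jk}dy^k$; $\sqrt{\Omega_{0,\sigma}}$ is the corresponding trivializing half-form, and the associated measure on $G\times i\mathfrak{t}\cong G\times\mathfrak{t}$ (the quotient of $T^*G$ by the $\mathfrak{t}^\perp$ directions) is $|\sqrt{\Omega_{0,\sigma}}|^2=\pi^{-r/2}\sigma_2^{r/2}(\det F)^{1/2}\,dx\,dy$, where $dx$ is the Haar measure given by $w^1\wedge\cdots\wedge w^n$ and $dy=dy^1\cdots dy^r$. Quantization: $L\to T^*G$ is the trivial complex line bundle with its standard Hermitian structure and connection $\nabla=d+i\theta$, so $C^\infty(L)=C^\infty(T^*G)\otimes\mathbb{C}$, and $$\mathcal{H}_{\mathcal{P}_{0,\sigma}}=\overline{\left\{s\otimes\sqrt{\Omega_{0,\sigma}}\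 \middle|\ s\in C^\infty(L),\ \nabla_{\overline{\mathcal{P}_{0,\sigma}}}s=0,\ \int_{G\times i\mathfrak{t}}\bar s s\,|\sqrt{\Omega_{0,\sigma}}|^2<\infty\right\}},$$ the closure being with respect to the inner product $\langle s\otimes\sqrt{\Omega_{0,\sigma}},s'\otimes\sqrt{\Omega_{0,\sigma}}\rangle_{0,\sigma}=\int_{G\times i\mathfrak{t}}\bar s s'\,|\sqrt{\Omega_{0,\sigma}}|^2$. In the integrals, integrands of polarized sections depend only on $x$ and on the $\mathfrak{t}$-component of $y$. *)

theory Defs
  imports
    "HOL-Analysis.Analysis"
    "HOL-Algebra.Group"
    "Jordan_Normal_Form.Determinant"
begin

section \<open>Smooth maps and Lie groups\<close>

text \<open>
  Only used for open \<open>S\<close> in a finite-dimensional space, where this is the usual notion of a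
  \<open>k\<close> times continuously differentiable map.
\<close>

primrec Ck :: "nat \<Rightarrow> 'a::real_normed_vector set \<Rightarrow> ('a \<Rightarrow> 'b::real_normed_vector) \<Rightarrow> bool" where
  "Ck 0 = (\<lambda>S f. continuous_on S f)"
| "Ck (Suc k) = (\<lambda>S f. (\<forall>x\<in>S. f differentiable (at x)) \<and>
     (\<forall>v. Ck k S (\<lambda>x. frechet_derivative f (at x) v)))"

definition smooth_on :: "'a::real_normed_vector set \<Rightarrow> ('a \<Rightarrow> 'b::real_normed_vector) \<Rightarrow> bool" where
  "smooth_on S f \<longleftrightarrow> (\<forall>k. Ck k S f)"

text \<open>
  A manifold is a topological space (given by the type class) with a smooth atlas. A chart is a
  pair of its domain and its coordinate map; the value of the coordinate map outside of the domain
  is irrelevant.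
\<close>

type_synonym ('m, 'a) atlas = "('m set \<times> ('m \<Rightarrow> 'a)) set"

definition is_chart :: "'m::topological_space set \<Rightarrow> ('m \<Rightarrow> 'a::real_normed_vector) \<Rightarrow> bool" where
  "is_chart U c \<longleftrightarrow> open U \<and> open (c ` U) \<and> homeomorphism U (c ` U) c (the_inv_into U c)"

definition smooth_atlas :: "('m::topological_space, 'a::real_normed_vector) atlas \<Rightarrow> bool" where
  "smooth_atlas \<A> \<longleftrightarrow>
     (\<forall>(U, c)\<in>\<A>. is_chart U c) \<and>
     (\<Union>(U, c)\<in>\<A>. U) = UNIV \<and>
     (\<forall>(U, c)\<in>\<A>. \<forall>(V, d)\<in>\<A>. smooth_on (c ` (U \<inter> V)) (d \<circ> the_inv_into U c))"

definition vec_atlas :: "('a::real_normed_vector, 'a) atlas" where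
  "vec_atlas = {(UNIV, \<lambda>x. x)}"

definition prod_atlas :: "('m, 'a) atlas \<Rightarrow> ('n, 'b) atlas \<Rightarrow> ('m \<times> 'n, 'a \<times> 'b) atlas" where
  "prod_atlas \<A> \<B> = {(U \<times> V, map_prod c d) | U V c d. (U, c) \<in> \<A> \<and> (V, d) \<in> \<B>}"

definition smooth_map ::
  "('m::topological_space, 'a::real_normed_vector) atlas \<Rightarrow>
   ('n::topological_space, 'b::real_normed_vector) atlas \<Rightarrow> ('m \<Rightarrow> 'n) \<Rightarrow> bool" where
  "smooth_map \<A> \<B> f \<longleftrightarrow> continuous_on UNIV f \<and>
     (\<forall>(U, c)\<in>\<A>. \<forall>(V, d)\<in>\<B>.
        smooth_on (c ` (U \<inter> f -` V)) (d \<circ> f \<circ> the_inv_into U c))"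

text \<open>
  The model space \<open>'a\<close> of the charts is a finite-dimensional real vector space; it will also serve
  as the Lie algebra. (The class \<open>real_inner\<close> rather than \<open>euclidean_space\<close> is used so that
  dimension 0 is not excluded.)
\<close>

definition lie_group ::
  "'g::{t2_space, second_countable_topology} monoid \<Rightarrow> ('g, 'a::real_inner) atlas \<Rightarrow> bool" where
  "lie_group G \<A> \<longleftrightarrow>
     Group.group G \<and> carrier G = UNIV \<and>
     (\<exists>B :: 'a set. finite B \<and> span B = UNIV) \<and>
     smooth_atlas \<A> \<and>
     smooth_map (prod_atlas \<A> \<A>) \<A> (\<lambda>(x, y). x \<otimes>\<^bsub>G\<^esub> y) \<and>
     smooth_map \<A> \<A> (\<lambda>x. m_inv G x)"

text \<open>The velocity at \<open>s = 0\<close> of \<open>s \<mapsto> x e\<^sup>s\<^sup>U\<close>, read in the chart \<open>c\<close>.\<close>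

definition left_velocity ::
  "'g monoid \<Rightarrow> ('a::real_inner \<Rightarrow> 'g) \<Rightarrow> ('g \<Rightarrow> 'a) \<Rightarrow> 'g \<Rightarrow> 'a \<Rightarrow> 'a" where
  "left_velocity G Exp c x U = vector_derivative (\<lambda>s::real. c (x \<otimes>\<^bsub>G\<^esub> Exp (s *\<^sub>R U))) (at 0)"

text \<open>
  The vector space \<open>'a\<close> is identified with the Lie algebra \<open>T\<^sub>e G\<close> by sending \<open>U\<close> to the velocity at
  the identity of the one-parameter subgroup \<open>s \<mapsto> Exp (s U)\<close>. The three conditions say that \<open>Exp\<close> is
  the exponential map under a linear identification of \<open>'a\<close> with \<open>T\<^sub>e G\<close>; the inner product on the
  Lie algebra is the one of the type \<open>'a\<close>.
\<close>

definition exponential_map ::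
  "'g::{t2_space, second_countable_topology} monoid \<Rightarrow> ('g, 'a::real_inner) atlas \<Rightarrow> ('a \<Rightarrow> 'g) \<Rightarrow> bool"
  where
  "exponential_map G \<A> Exp \<longleftrightarrow>
     smooth_map vec_atlas \<A> Exp \<and>
     (\<forall>U s t. Exp ((s + t) *\<^sub>R U) = Exp (s *\<^sub>R U) \<otimes>\<^bsub>G\<^esub> Exp (t *\<^sub>R U)) \<and>
     (\<forall>(W, c)\<in>\<A>. \<one>\<^bsub>G\<^esub> \<in> W \<longrightarrow> bij (left_velocity G Exp c \<one>\<^bsub>G\<^esub>))"

definition Ad :: "'g monoid \<Rightarrow> ('a::real_inner \<Rightarrow> 'g) \<Rightarrow> 'g \<Rightarrow> 'a \<Rightarrow> 'a" where
  "Ad G Exp x U =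
     (THE V. \<forall>s::real. Exp (s *\<^sub>R V) = x \<otimes>\<^bsub>G\<^esub> Exp (s *\<^sub>R U) \<otimes>\<^bsub>G\<^esub> m_inv G x)"

definition Ad_invariant_inner :: "'g monoid \<Rightarrow> ('a::real_inner \<Rightarrow> 'g) \<Rightarrow> bool" where
  "Ad_invariant_inner G Exp \<longleftrightarrow> (\<forall>x U V. Ad G Exp x U \<bullet> Ad G Exp x V = U \<bullet> V)"

definition is_torus :: "'g::topological_space monoid \<Rightarrow> 'g set \<Rightarrow> bool" where
  "is_torus G H \<longleftrightarrow> subgroup H G \<and> compact H \<and> connected H \<and>
     (\<forall>x\<in>H. \<forall>y\<in>H. x \<otimes>\<^bsub>G\<^esub> y = y \<otimes>\<^bsub>G\<^esub> x)"

definition maximal_torus :: "'g::topological_space monoid \<Rightarrow> 'g set \<Rightarrow> bool" where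
  "maximal_torus G H \<longleftrightarrow> is_torus G H \<and> (\<forall>K. is_torus G K \<and> H \<subseteq> K \<longrightarrow> K = H)"

definition lie_algebra_of :: "('a::real_vector \<Rightarrow> 'g) \<Rightarrow> 'g set \<Rightarrow> 'a set" where
  "lie_algebra_of Exp H = {U. \<forall>s::real. Exp (s *\<^sub>R U) \<in> H}"

text \<open>
  Indices start at 0: \<open>T 0, \<dots>, T (n - 1)\<close> is an orthonormal basis of the Lie algebra and
  \<open>T 0, \<dots>, T (r - 1)\<close> is a basis of \<open>\<tt>\<close>.
\<close>

definition adapted_basis :: "(nat \<Rightarrow> 'a::real_inner) \<Rightarrow> nat \<Rightarrow> nat \<Rightarrow> 'a set \<Rightarrow> bool" where
  "adapted_basis T n r \<tt> \<longleftrightarrow> r \<le> n \<and>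
     (\<forall>i<n. \<forall>j<n. T i \<bullet> T j = (if i = j then 1 else 0)) \<and>
     span (T ` {..<n}) = UNIV \<and> span (T ` {..<r}) = \<tt>"


section \<open>Measures\<close>

text \<open>
  The measure \<open>dy\<^sup>1 \<dots> dy\<^sup>m\<close> on the span of the orthonormal vectors \<open>T 0, \<dots>, T (m - 1)\<close>,
  as a Borel measure on the whole space that is concentrated on that span.
\<close>

definition coord_lebesgue :: "(nat \<Rightarrow> 'a::real_inner) \<Rightarrow> nat \<Rightarrow> 'a measure" where
  "coord_lebesgue T m =
     distr (Pi\<^sub>M {..<m} (\<lambda>_. lborel)) borel (\<lambda>y. \<Sum>j<m. y j *\<^sub>R T j)"

text \<open>
  \<open>\<mu>\<close> is the measure given by the left-invariant volume form \<open>w\<^sup>1 \<and> \<dots> \<and> w\<^sup>n\<close>: in a chart its density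
  with respect to Lebesgue measure is the absolute value of the volume form on the coordinate
  fields. Here \<open>left_coframe G Exp T c x i v\<close> is the value of \<open>w\<^sup>i\<close> on the tangent vector at \<open>x\<close> whose
  coordinate expression in the chart \<open>c\<close> is \<open>v\<close>.
\<close>

definition left_coframe ::
  "'g monoid \<Rightarrow> ('a::real_inner \<Rightarrow> 'g) \<Rightarrow> (nat \<Rightarrow> 'a) \<Rightarrow> ('g \<Rightarrow> 'a) \<Rightarrow> 'g \<Rightarrow> nat \<Rightarrow> 'a \<Rightarrow> real" where
  "left_coframe G Exp T c x i v = T i \<bullet> inv_into UNIV (left_velocity G Exp c x) v"

definition haar_volume ::
  "'g::topological_space monoid \<Rightarrow> ('g, 'a::real_inner) atlas \<Rightarrow> ('a \<Rightarrow> 'g) \<Rightarrow> (nat \<Rightarrow> 'a) \<Rightarrow> nat \<Rightarrow>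
   'g measure \<Rightarrow> bool" where
  "haar_volume G \<A> Exp T n \<mu> \<longleftrightarrow>
     sets \<mu> = sets borel \<and>
     (\<forall>(W, c)\<in>\<A>. \<forall>B\<in>sets borel. B \<subseteq> W \<longrightarrow>
        emeasure \<mu> B =
          (\<integral>\<^sup>+ z\<in>c ` B.
             ennreal \<bar>Determinant.det (Matrix.mat n n
               (\<lambda>(i, j). left_coframe G Exp T c (the_inv_into W c z) i (T j)))\<bar>
           \<partial>coord_lebesgue T n))"


section \<open>Complexified tangent vectors and the polarization\<close>

text \<open>\<open>Cplx A B\<close> is the element \<open>A + i B\<close> of the complexification of \<open>'a\<close>.\<close>

datatype 'a cplx = Cplx (rpart: 'a) (ipart: 'a)

definition cscale :: "complex \<Rightarrow> 'a::real_vector cplx \<Rightarrow> 'a cplx" where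
  "cscale z A = Cplx (Re z *\<^sub>R rpart A - Im z *\<^sub>R ipart A) (Re z *\<^sub>R ipart A + Im z *\<^sub>R rpart A)"

definition cconj :: "'a::real_vector cplx \<Rightarrow> 'a cplx" where
  "cconj A = Cplx (rpart A) (- ipart A)"

definition cmap :: "('a \<Rightarrow> 'b) \<Rightarrow> 'a cplx \<Rightarrow> 'b cplx" where
  "cmap F A = Cplx (F (rpart A)) (F (ipart A))"

text \<open>The complex linear extension of \<open>\<langle>u, \<cdot>\<rangle>\<close>.\<close>

definition cpair :: "'a::real_inner \<Rightarrow> 'a cplx \<Rightarrow> complex" where
  "cpair u A = Complex (u \<bullet> rpart A) (u \<bullet> ipart A)"

text \<open>
  In the left trivialization, the complexified tangent space of \<open>T\<^sup>*G\<close> at every point consists of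
  pairs \<open>(U, V)\<close> of elements of the complexified Lie algebra, and the polarization is the same
  subspace at every point.
\<close>

type_synonym 'a ctangent = "'a cplx \<times> 'a cplx"

definition mixed_polarization :: "('a::real_inner \<Rightarrow> 'a) \<Rightarrow> complex \<Rightarrow> 'a ctangent set" where
  "mixed_polarization F \<sigma> = {(cscale (- cnj \<sigma>) (cmap F A), A) | A. True}"

definition conj_polarization :: "'a::real_vector ctangent set \<Rightarrow> 'a ctangent set" where
  "conj_polarization P = (\<lambda>(U, V). (cconj U, cconj V)) ` P"

definition tangent_derivative ::
  "'g monoid \<Rightarrow> ('a::real_inner \<Rightarrow> 'g) \<Rightarrow> ('g \<times> 'a \<Rightarrow> complex) \<Rightarrow> 'g \<times> 'a \<Rightarrow> 'a \<times> 'a \<Rightarrow> complex" where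
  "tangent_derivative G Exp \<phi> = (\<lambda>(x, y) (U, V).
     vector_derivative (\<lambda>s::real. \<phi> (x \<otimes>\<^bsub>G\<^esub> Exp (s *\<^sub>R U), y + s *\<^sub>R V)) (at 0))"

definition ctangent_derivative ::
  "'g monoid \<Rightarrow> ('a::real_inner \<Rightarrow> 'g) \<Rightarrow> ('g \<times> 'a \<Rightarrow> complex) \<Rightarrow> 'g \<times> 'a \<Rightarrow> 'a ctangent \<Rightarrow> complex" where
  "ctangent_derivative G Exp \<phi> p = (\<lambda>(U, V).
     tangent_derivative G Exp \<phi> p (rpart U, rpart V) +
     \<i> * tangent_derivative G Exp \<phi> p (ipart U, ipart V))"

definition canonical_form :: "'g \<times> 'a::real_inner \<Rightarrow> 'a ctangent \<Rightarrow> complex" where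
  "canonical_form = (\<lambda>(x, y) (U, V). cpair y U)"

definition covariant_derivative ::
  "'g monoid \<Rightarrow> ('a::real_inner \<Rightarrow> 'g) \<Rightarrow> ('g \<times> 'a \<Rightarrow> complex) \<Rightarrow> 'g \<times> 'a \<Rightarrow> 'a ctangent \<Rightarrow> complex" where
  "covariant_derivative G Exp s p X =
     ctangent_derivative G Exp s p X + \<i> * canonical_form p X * s p"

definition smooth_functions ::
  "('g::topological_space, 'a::real_inner) atlas \<Rightarrow> ('g \<times> 'a \<Rightarrow> complex) set" where
  "smooth_functions \<A> = {\<phi>. smooth_map (prod_atlas \<A> vec_atlas) vec_atlas \<phi>}"

definition polarized_functions ::
  "'g::topological_space monoid \<Rightarrow> ('g, 'a::real_inner) atlas \<Rightarrow> ('a \<Rightarrow> 'g) \<Rightarrow> 'a ctangent set \<Rightarrow>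
   ('g \<times> 'a \<Rightarrow> complex) set" where
  "polarized_functions G \<A> Exp P =
     {\<phi> \<in> smooth_functions \<A>. \<forall>p. \<forall>X\<in>conj_polarization P. ctangent_derivative G Exp \<phi> p X = 0}"

definition polarized_sections ::
  "'g::topological_space monoid \<Rightarrow> ('g, 'a::real_inner) atlas \<Rightarrow> ('a \<Rightarrow> 'g) \<Rightarrow> 'a ctangent set \<Rightarrow>
   ('g \<times> 'a \<Rightarrow> complex) set" where
  "polarized_sections G \<A> Exp P =
     {s \<in> smooth_functions \<A>. \<forall>p. \<forall>X\<in>conj_polarization P. covariant_derivative G Exp s p X = 0}"

definition energy :: "('a::real_inner \<Rightarrow> 'a) \<Rightarrow> 'g \<times> 'a \<Rightarrow> real" where
  "energy F = (\<lambda>(x, y). 1 / 2 * (y \<bullet> F y))"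

definition lambda_fun :: "('a::real_inner \<Rightarrow> 'a) \<Rightarrow> complex \<Rightarrow> 'g \<times> 'a \<Rightarrow> complex" where
  "lambda_fun F \<sigma> p = - \<sigma> * of_real (energy F p)"

definition kappa_fun :: "('a::real_inner \<Rightarrow> 'a) \<Rightarrow> complex \<Rightarrow> 'g \<times> 'a \<Rightarrow> real" where
  "kappa_fun F \<sigma> p = 2 * Im \<sigma> * energy F p"


section \<open>Half-forms and the quantum Hilbert space\<close>

text \<open>The wedge product \<open>\<eta> 0 \<and> \<dots> \<and> \<eta> (n - 1)\<close>, evaluated on \<open>v 0, \<dots>, v (n - 1)\<close>.\<close>

definition wedge :: "nat \<Rightarrow> (nat \<Rightarrow> 'v \<Rightarrow> complex) \<Rightarrow> (nat \<Rightarrow> 'v) \<Rightarrow> complex" where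
  "wedge n \<eta> v = Determinant.det (Matrix.mat n n (\<lambda>(i, j). \<eta> i (v j)))"

definition w_form :: "(nat \<Rightarrow> 'a::real_inner) \<Rightarrow> nat \<Rightarrow> 'a ctangent \<Rightarrow> complex" where
  "w_form T j = (\<lambda>(U, V). cpair (T j) U)"

definition dy_form :: "(nat \<Rightarrow> 'a::real_inner) \<Rightarrow> nat \<Rightarrow> 'a ctangent \<Rightarrow> complex" where
  "dy_form T j = (\<lambda>(U, V). cpair (T j) V)"

definition dz_form ::
  "(nat \<Rightarrow> 'a::real_inner) \<Rightarrow> nat \<Rightarrow> ('a \<Rightarrow> 'a) \<Rightarrow> complex \<Rightarrow> nat \<Rightarrow> 'a ctangent \<Rightarrow> complex" where
  "dz_form T r F \<sigma> j X =
     w_form T j X + \<sigma> * (\<Sum>k<r. of_real (T j \<bullet> F (T k)) * dy_form T k X)"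

type_synonym 'a nform = "(nat \<Rightarrow> 'a ctangent) \<Rightarrow> complex"

definition Omega ::
  "(nat \<Rightarrow> 'a::real_inner) \<Rightarrow> nat \<Rightarrow> nat \<Rightarrow> ('a \<Rightarrow> 'a) \<Rightarrow> complex \<Rightarrow> 'a nform" where
  "Omega T n r F \<sigma> = wedge n (\<lambda>j. if j < r then dz_form T r F \<sigma> j else w_form T j)"

text \<open>
  The half-form bundle is trivialized by \<open>\<surd>\<Omega>\<close>, so that a half-form corrected section is
  uniquely \<open>s \<otimes> \<surd>\<Omega>\<close>. It is represented by its coefficient together with the \<open>n\<close>-form
  \<open>\<Omega>\<close> whose square root is the trivializing frame.
\<close>

datatype ('s, 'w) half_form_section = Tensor_Sqrt 's 'w (infix \<open>\<otimes>\<surd>\<close> 60)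

text \<open>\<open>\<bar>\<surd>\<Omega>\<bar>\<^sup>2\<close>, as a measure on \<open>G \<times> 'a\<close> concentrated on \<open>G \<times> \<tt>\<close>; \<open>dx\<close> is the measure \<open>\<mu>\<close>.\<close>

definition det_torus :: "(nat \<Rightarrow> 'a::real_inner) \<Rightarrow> nat \<Rightarrow> ('a \<Rightarrow> 'a) \<Rightarrow> real" where
  "det_torus T r F = Determinant.det (Matrix.mat r r (\<lambda>(j, k). T j \<bullet> F (T k)))"

definition half_form_measure ::
  "(nat \<Rightarrow> 'a::real_inner) \<Rightarrow> nat \<Rightarrow> ('a \<Rightarrow> 'a) \<Rightarrow> complex \<Rightarrow> 'g measure \<Rightarrow> ('g \<times> 'a) measure" where
  "half_form_measure T r F \<sigma> \<mu> =
     scale_measure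
       (ennreal (pi powr (- real r / 2) * Im \<sigma> powr (real r / 2) * sqrt (det_torus T r F)))
       (\<mu> \<Otimes>\<^sub>M coord_lebesgue T r)"

definition half_form_inner ::
  "'p measure \<Rightarrow> ('p \<Rightarrow> complex) \<Rightarrow> ('p \<Rightarrow> complex) \<Rightarrow> complex" where
  "half_form_inner M s s' = (\<integral>p. cnj (s p) * s' p \<partial>M)"

definition L2_class :: "'p measure \<Rightarrow> ('p \<Rightarrow> complex) \<Rightarrow> ('p \<Rightarrow> complex) set" where
  "L2_class M \<psi> = {h \<in> borel_measurable M. AE p in M. h p = \<psi> p}"

text \<open>
  The closure of a set of square integrable sections with respect to the inner product above, taken
  in the \<open>L\<^sup>2\<close> space of \<open>M\<close>: the coefficients of its elements are almost everywhere classes.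
\<close>

definition half_form_closure ::
  "'p measure \<Rightarrow> ('p \<Rightarrow> complex, 'w) half_form_section set \<Rightarrow>
   (('p \<Rightarrow> complex) set, 'w) half_form_section set" where
  "half_form_closure M S =
     {L2_class M \<psi> \<otimes>\<surd> \<Omega> | \<psi> \<Omega>.
        \<psi> \<in> borel_measurable M \<and> (\<integral>\<^sup>+ p. ennreal ((cmod (\<psi> p))\<^sup>2) \<partial>M) < \<infinity> \<and>
        (\<exists>s. (\<forall>k::nat. s k \<otimes>\<surd> \<Omega> \<in> S) \<and>
           (\<lambda>k. sqrt (Re (half_form_inner M (\<lambda>p. s k p - \<psi> p) (\<lambda>p. s k p - \<psi> p))))
             \<longlonglongrightarrow> 0)}"

definition quantum_space ::
  "'g::topological_space monoid \<Rightarrow> ('g, 'a::real_inner) atlas \<Rightarrow> ('a \<Rightarrow> 'g) \<Rightarrow> (nat \<Rightarrow> 'a) \<Rightarrow>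
   nat \<Rightarrow> nat \<Rightarrow> ('a \<Rightarrow> 'a) \<Rightarrow> complex \<Rightarrow> 'g measure \<Rightarrow>
   (('g \<times> 'a \<Rightarrow> complex) set, 'a nform) half_form_section set" where
  "quantum_space G \<A> Exp T n r F \<sigma> \<mu> =
     half_form_closure (half_form_measure T r F \<sigma> \<mu>)
       {s \<otimes>\<surd> Omega T n r F \<sigma> | s.
          s \<in> polarized_sections G \<A> Exp (mixed_polarization F \<sigma>) \<and>
          (\<integral>\<^sup>+ p. ennreal ((cmod (s p))\<^sup>2) \<partial>half_form_measure T r F \<sigma> \<mu>) < \<infinity>}"

end

theory Submission
  imports Defs
begin

no_notation Matrix.scalar_prod (infix "\<bullet>" 70)

text \<open>
  Both spaces are closures of the same set: multiplication by the nowhere vanishing function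
  \<open>e\<^sup>-\<^sup>i\<^sup>\<lambda> = e\<^sup>i\<^sup>\<sigma>\<^sup>f\<close> is a bijection from polarized functions to polarized sections. A vector of the
  conjugate polarization has the form \<open>X = (-\<sigma> F B, B)\<close>, so that
  \<open>X(i \<sigma> f) + i \<theta>(X) = i \<sigma> \<langle>F y, B\<rangle> - i \<sigma> \<langle>y, F B\<rangle> = 0\<close> by self-adjointness of \<open>F\<close>, and hence
  \<open>\<nabla>\<^sub>X (\<phi> e\<^sup>-\<^sup>i\<^sup>\<lambda>) = e\<^sup>-\<^sup>i\<^sup>\<lambda> X(\<phi>)\<close>. Moreover \<open>\<bar>e\<^sup>-\<^sup>i\<^sup>\<lambda>\<bar>\<^sup>2 = e\<^sup>-\<^sup>\<kappa>\<close>.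
\<close>

section \<open>Calculus of smooth functions\<close>

text \<open>\<open>frechet_derivative\<close> chooses from the set of derivatives at
  \<open>x\<close>, and functions that agree near \<open>x\<close> have the same such set.\<close>

lemma frechet_derivative_cong_open:
  assumes "open S" "x \<in> S" "\<And>y. y \<in> S \<Longrightarrow> f y = g y"
  shows "frechet_derivative f (at x) = frechet_derivative g (at x)"
proof -
  have "(f has_derivative D) (at x) \<longleftrightarrow> (g has_derivative D) (at x)" for D
    using has_derivative_transform_within_open[OF _ assms(1,2)] assms(3) by metis
  then show ?thesis
    unfolding frechet_derivative_def by simp
qed

text \<open>Derivative formulas are known only at points of \<open>S\<close>, whereas
  \<open>Ck\<close> speaks of functions on the whole space. Since \<open>S\<close> is open, the
  values on \<open>S\<close> determine all derivatives there.\<close>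

lemma Ck_cong:
  assumes "open S" "\<And>x. x \<in> S \<Longrightarrow> f x = g x" "Ck k S f"
  shows "Ck k S g"
  using assms(2,3)
proof (induction k arbitrary: f g)
  case 0
  then show ?case by (metis (no_types, lifting) Ck.simps(1) continuous_on_cong)
next
  case (Suc k)
  have "g differentiable (at x)" if x: "x \<in> S" for x
  proof -
    have "(f has_derivative frechet_derivative f (at x)) (at x)"
      using Suc.prems(2) x by (simp add: frechet_derivative_works)
    then have "(g has_derivative frechet_derivative f (at x)) (at x)"
      by (rule has_derivative_transform_within_open[OF _ assms(1) x Suc.prems(1)])
    then show ?thesis by (rule differentiableI)
  qed
  moreover have "Ck k S (\<lambda>x. frechet_derivative g (at x) v)" for v
  proof (rule Suc.IH)
    show "Ck k S (\<lambda>x. frechet_derivative f (at x) v)" using Suc.prems by simp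
    show "frechet_derivative f (at x) v = frechet_derivative g (at x) v" if "x \<in> S" for x
      using frechet_derivative_cong_open[OF assms(1) that Suc.prems(1)] by simp
  qed
  ultimately show ?case by simp
qed

text \<open>Replaces the chosen \<open>frechet_derivative\<close> by an explicit formula
  \<open>D\<close>: derivatives are unique, so the two agree on \<open>S\<close> and
  \<open>Ck_cong\<close> applies.\<close>

lemma Ck_SucI:
  assumes "open S" "\<And>x. x \<in> S \<Longrightarrow> (f has_derivative D x) (at x)"
    and "\<And>v. Ck k S (\<lambda>x. D x v)"
  shows "Ck (Suc k) S f"
proof -
  have "Ck k S (\<lambda>x. frechet_derivative f (at x) v)" for v
    by (rule Ck_cong[OF assms(1) _ assms(3)[of v]])
       (rule fun_cong[OF frechet_derivative_at[OF assms(2)]])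
  then show ?thesis
    using assms(2) by (auto simp: differentiable_def)
qed

lemma Ck_Suc_has_derivative:
  assumes "Ck (Suc k) S f" "x \<in> S"
  shows "(f has_derivative frechet_derivative f (at x)) (at x)"
  using assms by (simp add: frechet_derivative_works)

lemma Ck_Suc_imp_Ck: "Ck (Suc k) S f \<Longrightarrow> Ck k S f"
proof (induction k arbitrary: f)
  case 0
  then show ?case
    by (auto intro!: continuous_at_imp_continuous_on differentiable_imp_continuous_within)
next
  case (Suc k)
  then show ?case by (metis Ck.simps(2))
qed

section \<open>Closure rules for the classes \<open>Ck k S\<close>\<close>

lemma Ck_const:
  assumes "open S"
  shows "Ck k S (\<lambda>x. c)"
proof (induction k arbitrary: c)
  case (Suc k)
  show ?case
    by (rule Ck_SucI[OF assms has_derivative_const Suc])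
qed simp

lemma Ck_bounded_linear:
  assumes "open S" "bounded_linear f"
  shows "Ck k S f"
proof (cases k)
  case 0
  then show ?thesis using assms(2) by (simp add: linear_continuous_on)
next
  case (Suc m)
  show ?thesis
    unfolding Suc
    by (rule Ck_SucI[OF assms(1) bounded_linear_imp_has_derivative[OF assms(2)] Ck_const[OF assms(1)]])
qed

lemma Ck_add:
  assumes "open S" "Ck k S f" "Ck k S g"
  shows "Ck k S (\<lambda>x. f x + g x)"
  using assms(2,3)
proof (induction k arbitrary: f g)
  case 0
  then show ?case by (simp add: continuous_on_add)
next
  case (Suc k)
  show ?case
    by (rule Ck_SucI[OF assms(1)
          has_derivative_add[OF Ck_Suc_has_derivative Ck_Suc_has_derivative]])
       (use Suc in auto)
qed

text \<open>Each summand of the product rule keeps one undifferentiated factor, so \<open>f\<close>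
  and \<open>g\<close> are lowered from order \<open>Suc k\<close> to \<open>k\<close> before the
  induction hypothesis applies.\<close>

lemma Ck_mult:
  fixes f g :: "'a::real_normed_vector \<Rightarrow> 'b::real_normed_algebra"
  assumes "open S" "Ck k S f" "Ck k S g"
  shows "Ck k S (\<lambda>x. f x * g x)"
  using assms(2,3)
proof (induction k arbitrary: f g)
  case 0
  then show ?case by (simp add: continuous_on_mult)
next
  case (Suc k)
  have "Ck k S f" "Ck k S g"
    using Suc.prems by (simp_all only: Ck_Suc_imp_Ck)
  then show ?case
    by (intro Ck_SucI[OF assms(1)
          has_derivative_mult[OF Ck_Suc_has_derivative[OF Suc.prems(1)]
            Ck_Suc_has_derivative[OF Suc.prems(2)]]]
          Ck_add[OF assms(1)] Suc.IH)
       (use Suc.prems in auto)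
qed

text \<open>The derivative is the same exponential times the derivative of \<open>g\<close>, so the
  induction can keep \<open>g\<close> fixed and rely on \<open>Ck_mult\<close>.\<close>

lemma Ck_exp:
  fixes g :: "'a::real_normed_vector \<Rightarrow> complex"
  assumes "open S" "Ck k S g"
  shows "Ck k S (\<lambda>x. exp (g x))"
  using assms(2)
proof (induction k)
  case 0
  then show ?case by (simp add: continuous_on_exp)
next
  case (Suc k)
  have deriv: "((\<lambda>x. exp (g x)) has_derivative (\<lambda>v. exp (g x) * frechet_derivative g (at x) v)) (at x)"
    if "x \<in> S" for x
    using has_derivative_compose[OF Ck_Suc_has_derivative[OF Suc.prems that]
        DERIV_exp[unfolded has_field_derivative_def]] by simp
  have "Ck k S g" using Suc.prems by (rule Ck_Suc_imp_Ck)
  then have "Ck k S (\<lambda>x. exp (g x))" by (rule Suc.IH)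
  moreover have "Ck k S (\<lambda>x. frechet_derivative g (at x) v)" for v
    using Suc.prems by simp
  ultimately show ?case
    by (intro Ck_SucI[OF assms(1) deriv] Ck_mult[OF assms(1)])
qed

section \<open>Differentiable curves in a manifold\<close>

text \<open>Continuity at 0 is a separate clause: \<open>c\<close> is arbitrary outside
  \<open>U\<close>, so differentiability of \<open>c (\<gamma> s)\<close> does not keep the curve in
  \<open>U\<close>. Openness and injectivity are recorded so that curves in a product can be treated
  without first proving the product atlas smooth.\<close>

definition curve_diff_at0 :: "('m::topological_space, 'a::real_normed_vector) atlas \<Rightarrow> (real \<Rightarrow> 'm) \<Rightarrow> bool"
  where "curve_diff_at0 \<A> \<gamma> \<longleftrightarrow> (\<gamma> \<longlongrightarrow> \<gamma> 0) (nhds 0) \<and>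
    (\<exists>(U, c)\<in>\<A>. open U \<and> inj_on c U \<and> \<gamma> 0 \<in> U \<and> (\<lambda>s. c (\<gamma> s)) differentiable (at 0))"

lemma smooth_atlas_chart:
  assumes "smooth_atlas \<A>" "(U, c) \<in> \<A>"
  shows "open U" "inj_on c U" "open (c ` U)"
  using assms unfolding smooth_atlas_def is_chart_def homeomorphism_def
  by (auto intro!: inj_on_inverseI[where g = "the_inv_into U c"])

lemma smooth_atlas_vec_atlas: "smooth_atlas (vec_atlas :: ('a::real_normed_vector, 'a) atlas)"
proof -
  have inv: "the_inv_into UNIV (\<lambda>x::'a. x) = (\<lambda>x. x)"
    by (rule ext) (rule the_inv_into_f_f[of "\<lambda>x. x" UNIV, simplified])
  have "smooth_on UNIV (\<lambda>x::'a. x)"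
    using Ck_bounded_linear[OF open_UNIV bounded_linear_ident] by (auto simp: smooth_on_def)
  then show ?thesis
    by (auto simp: smooth_atlas_def vec_atlas_def is_chart_def inv homeomorphism_def comp_def)
qed

lemma curve_diff_at0_vec_atlas:
  "curve_diff_at0 vec_atlas \<gamma> \<longleftrightarrow> \<gamma> differentiable (at 0)"
  using differentiable_imp_continuous_within[of \<gamma> 0 UNIV]
  by (auto simp: curve_diff_at0_def vec_atlas_def isCont_def tendsto_at_iff_tendsto_nhds)

lemma curve_diff_at0_const:
  assumes "smooth_atlas \<A>"
  shows "curve_diff_at0 \<A> (\<lambda>s. x)"
proof -
  obtain U c where "(U, c) \<in> \<A>" "x \<in> U"
    using assms unfolding smooth_atlas_def by blast
  then show ?thesis
    using smooth_atlas_chart[OF assms] unfolding curve_diff_at0_def by fastforce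
qed

lemma curve_diff_at0_Pair:
  assumes "curve_diff_at0 \<A> \<gamma>" "curve_diff_at0 \<B> \<delta>"
  shows "curve_diff_at0 (prod_atlas \<A> \<B>) (\<lambda>s. (\<gamma> s, \<delta> s))"
proof -
  obtain U c V d where
    "(U, c) \<in> \<A>" "open U" "inj_on c U" "\<gamma> 0 \<in> U" "(\<lambda>s. c (\<gamma> s)) differentiable (at 0)"
    "(V, d) \<in> \<B>" "open V" "inj_on d V" "\<delta> 0 \<in> V" "(\<lambda>s. d (\<delta> s)) differentiable (at 0)"
    using assms unfolding curve_diff_at0_def by blast
  moreover from this have "(\<lambda>s. (c (\<gamma> s), d (\<delta> s))) differentiable (at 0)"
    by simp
  moreover have "((\<lambda>s. (\<gamma> s, \<delta> s)) \<longlongrightarrow> (\<gamma> 0, \<delta> 0)) (nhds 0)"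
    using assms by (simp add: curve_diff_at0_def tendsto_Pair)
  ultimately have "(U \<times> V, map_prod c d) \<in> prod_atlas \<A> \<B>" "open (U \<times> V)"
    "inj_on (map_prod c d) (U \<times> V)" "(\<gamma> 0, \<delta> 0) \<in> U \<times> V"
    "(\<lambda>s. map_prod c d (\<gamma> s, \<delta> s)) differentiable (at 0)"
    "((\<lambda>s. (\<gamma> s, \<delta> s)) \<longlongrightarrow> (\<gamma> 0, \<delta> 0)) (nhds 0)"
    by (auto simp: prod_atlas_def open_Times map_prod_inj_on)
  then show ?thesis
    unfolding curve_diff_at0_def by blast
qed

text \<open>Chain rule in charts: near 0, \<open>d (f (\<gamma> s))\<close> is the coordinate
  expression \<open>?g\<close> of \<open>f\<close> evaluated at
  \<open>c (\<gamma> s)\<close>.\<close>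

lemma curve_diff_at0_smooth_map:
  assumes f: "smooth_map \<A> \<B> f" and \<B>: "smooth_atlas \<B>" and \<gamma>: "curve_diff_at0 \<A> \<gamma>"
  shows "curve_diff_at0 \<B> (\<lambda>s. f (\<gamma> s))"
proof -
  obtain U c where U: "(U, c) \<in> \<A>" "open U" "inj_on c U" "\<gamma> 0 \<in> U"
    and c: "(\<lambda>s. c (\<gamma> s)) differentiable (at 0)"
    using \<gamma> unfolding curve_diff_at0_def by blast
  obtain V d where V: "(V, d) \<in> \<B>" "f (\<gamma> 0) \<in> V"
    using \<B> unfolding smooth_atlas_def by blast
  have \<gamma>_lim: "(\<gamma> \<longlongrightarrow> \<gamma> 0) (nhds 0)" using \<gamma> by (simp add: curve_diff_at0_def)
  have "(f \<longlongrightarrow> f (\<gamma> 0)) (nhds (\<gamma> 0))"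
    using f by (simp add: smooth_map_def continuous_on_def tendsto_at_iff_tendsto_nhds)
  then have lim: "((\<lambda>s. f (\<gamma> s)) \<longlongrightarrow> f (\<gamma> 0)) (nhds 0)"
    using \<gamma>_lim by (rule filterlim_compose)
  let ?g = "d \<circ> f \<circ> the_inv_into U c"
  have "Ck (Suc 0) (c ` (U \<inter> f -` V)) ?g"
    using f U(1) V(1) unfolding smooth_map_def smooth_on_def by blast
  moreover have "c (\<gamma> 0) \<in> c ` (U \<inter> f -` V)"
    using U V by auto
  ultimately have "?g differentiable (at (c (\<gamma> 0)))"
    unfolding Ck.simps by blast
  then have "(\<lambda>s. ?g (c (\<gamma> s))) differentiable (at 0)"
    using differentiable_chain_at[OF c] by (simp add: comp_def)
  \<comment> \<open>The inverse chart cancels \<open>c\<close> only while the curve stays in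
    \<open>U\<close>, which continuity at 0 ensures for small \<open>s\<close>.\<close>
  moreover have "\<forall>\<^sub>F s in nhds 0. ?g (c (\<gamma> s)) = d (f (\<gamma> s))"
  proof -
    have "\<forall>\<^sub>F s in nhds 0. \<gamma> s \<in> U"
      using topological_tendstoD[OF \<gamma>_lim U(2,4)] .
    then show ?thesis
      by eventually_elim (simp add: the_inv_into_f_f[OF U(3)])
  qed
  then obtain S where "open S" "0 \<in> S" "\<And>s. s \<in> S \<Longrightarrow> ?g (c (\<gamma> s)) = d (f (\<gamma> s))"
    unfolding eventually_nhds by blast
  ultimately have "(\<lambda>s. d (f (\<gamma> s))) differentiable (at 0)"
    unfolding differentiable_def by (blast intro: has_derivative_transform_within_open)
  then show ?thesis
    using lim V smooth_atlas_chart[OF \<B> V(1)] unfolding curve_diff_at0_def by blast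
qed

section \<open>Differentiability along one-parameter subgroups\<close>

lemma exponential_map_0:
  assumes "lie_group G \<A>" "exponential_map G \<A> Exp"
  shows "Exp 0 = \<one>\<^bsub>G\<^esub>"
proof -
  interpret group G using assms(1) by (simp add: lie_group_def)
  \<comment> \<open>\<open>Exp 0\<close> is idempotent, and the identity is the only idempotent of a
    group.\<close>
  have "Exp ((0 + 0) *\<^sub>R 0) = Exp (0 *\<^sub>R 0) \<otimes>\<^bsub>G\<^esub> Exp (0 *\<^sub>R 0)"
    using assms(2) unfolding exponential_map_def by blast
  moreover have "Exp 0 \<in> carrier G" using assms(1) by (simp add: lie_group_def)
  ultimately show ?thesis by simp
qed

text \<open>\<open>vector_derivative\<close> is meaningful only for differentiable curves, so this
  gives access to the product rule for \<open>tangent_derivative\<close>. The curve arises from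
  straight lines through \<open>Exp\<close>, the multiplication and \<open>\<phi>\<close>, all of
  them smooth.\<close>

lemma smooth_function_curve_differentiable:
  assumes G: "lie_group G \<A>" "exponential_map G \<A> Exp" and "\<phi> \<in> smooth_functions \<A>"
  shows "(\<lambda>s::real. \<phi> (x \<otimes>\<^bsub>G\<^esub> Exp (s *\<^sub>R U), y + s *\<^sub>R V)) differentiable (at 0)"
proof -
  have \<A>: "smooth_atlas \<A>" using G by (simp add: lie_group_def)
  have "curve_diff_at0 vec_atlas (\<lambda>s. s *\<^sub>R U)" "curve_diff_at0 vec_atlas (\<lambda>s. y + s *\<^sub>R V)"
    unfolding curve_diff_at0_vec_atlas by (auto intro!: derivative_intros)
  moreover from this have "curve_diff_at0 \<A> (\<lambda>s. Exp (s *\<^sub>R U))"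
    using G(2) curve_diff_at0_smooth_map[OF _ \<A>] by (auto simp: exponential_map_def)
  then have "curve_diff_at0 (prod_atlas \<A> \<A>) (\<lambda>s. (x, Exp (s *\<^sub>R U)))"
    by (intro curve_diff_at0_Pair curve_diff_at0_const \<A>)
  then have "curve_diff_at0 \<A> (\<lambda>s. x \<otimes>\<^bsub>G\<^esub> Exp (s *\<^sub>R U))"
    using curve_diff_at0_smooth_map[of "prod_atlas \<A> \<A>" \<A> "\<lambda>(x, y). x \<otimes>\<^bsub>G\<^esub> y"] G(1) \<A>
    by (fastforce simp: lie_group_def)
  ultimately have "curve_diff_at0 (prod_atlas \<A> vec_atlas)
      (\<lambda>s. (x \<otimes>\<^bsub>G\<^esub> Exp (s *\<^sub>R U), y + s *\<^sub>R V))"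
    by (intro curve_diff_at0_Pair)
  then have "curve_diff_at0 vec_atlas (\<lambda>s. \<phi> (x \<otimes>\<^bsub>G\<^esub> Exp (s *\<^sub>R U), y + s *\<^sub>R V))"
    using curve_diff_at0_smooth_map[OF _ smooth_atlas_vec_atlas] assms(3)
    by (auto simp: smooth_functions_def)
  then show ?thesis by (simp add: curve_diff_at0_vec_atlas)
qed

text \<open>A vector space has the identity as its single chart, so the charts of the product are
  those of the group times the identity, and the target needs no coordinates.\<close>

lemma smooth_functions_iff:
  fixes \<phi> :: "'g::topological_space \<times> 'a::real_inner \<Rightarrow> complex"
  shows "\<phi> \<in> smooth_functions \<A> \<longleftrightarrow> continuous_on UNIV \<phi> \<and>
    (\<forall>(U, c)\<in>\<A>. smooth_on (map_prod c (\<lambda>y. y) ` (U \<times> UNIV))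
      (\<lambda>z. \<phi> (the_inv_into (U \<times> UNIV) (map_prod c (\<lambda>y. y)) z)))"
proof -
  have "prod_atlas \<A> (vec_atlas :: ('a, 'a) atlas) =
      (\<lambda>(U, c). (U \<times> UNIV, map_prod c (\<lambda>y. y))) ` \<A>"
    by (force simp: prod_atlas_def vec_atlas_def)
  then show ?thesis
    by (simp add: smooth_functions_def smooth_map_def vec_atlas_def[where 'a = complex]
        case_prod_unfold comp_def)
qed

section \<open>The trivializing polarized section\<close>

text \<open>The class \<open>real_inner\<close> does not provide continuity of linear maps, so it is read off the basis.\<close>

lemma adapted_basis_expansion:
  assumes "adapted_basis T n r \<tt>"
  shows "(\<Sum>j<n. (y \<bullet> T j) *\<^sub>R T j) = y"
proof -
  have "y \<in> span (T ` {..<n})" using assms by (simp add: adapted_basis_def)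
  then show ?thesis
  proof (induction rule: span_induct_alt)
    case (step c x z)
    then obtain i where i: "i < n" "x = T i" by auto
    have "(\<Sum>j<n. ((c *\<^sub>R x) \<bullet> T j) *\<^sub>R T j) = (\<Sum>j<n. if i = j then c *\<^sub>R T j else 0)"
      using assms i by (intro sum.cong) (auto simp: adapted_basis_def)
    also have "\<dots> = c *\<^sub>R x" using i by (simp add: sum.delta)
    finally show ?case
      using step by (simp add: inner_add_left scaleR_add_left sum.distrib)
  qed simp
qed

text \<open>The basis expansion writes \<open>F\<close> as a finite sum of inner products with basis
  vectors times fixed values.\<close>

lemma adapted_basis_bounded_linear:
  fixes T :: "nat \<Rightarrow> 'a::real_inner" and F :: "'a \<Rightarrow> 'b::real_normed_vector"
  assumes "adapted_basis T n r \<tt>" "linear F"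
  shows "bounded_linear F"
proof -
  have "F = (\<lambda>y. \<Sum>j<n. (y \<bullet> T j) *\<^sub>R F (T j))"
  proof
    fix y
    have "F y = F (\<Sum>j<n. (y \<bullet> T j) *\<^sub>R T j)"
      by (simp add: adapted_basis_expansion[OF assms(1)])
    also have "\<dots> = (\<Sum>j<n. (y \<bullet> T j) *\<^sub>R F (T j))"
      by (simp add: linear_sum[OF assms(2)] linear_scale[OF assms(2)])
    finally show "F y = (\<Sum>j<n. (y \<bullet> T j) *\<^sub>R F (T j))" .
  qed
  moreover have "bounded_linear (\<lambda>y. \<Sum>j<n. (y \<bullet> T j) *\<^sub>R F (T j))"
    by (intro bounded_linear_sum bounded_linear_compose[OF bounded_linear_scaleR_left]
        bounded_linear_inner_left)
  ultimately show ?thesis by simp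
qed

section \<open>Exponentials of the quadratic function of a self-adjoint map\<close>

context
  fixes F :: "'a::real_inner \<Rightarrow> 'a"
  assumes F: "bounded_linear F" and self_adjoint: "\<And>u v. F u \<bullet> v = u \<bullet> F v"
begin

text \<open>Self-adjointness merges the two terms of the product rule. The constant \<open>c\<close>
  stays arbitrary because both the exponential and its reciprocal will be needed.\<close>

lemma quadratic_has_derivative:
  "((\<lambda>y. c * of_real (y \<bullet> F y)) has_derivative (\<lambda>v. c * of_real (2 * (v \<bullet> F y)))) (at y)"
  for c :: complex
proof -
  have "y \<bullet> F v + v \<bullet> F y = 2 * (v \<bullet> F y)" for v
    using self_adjoint[of y v] by (simp add: inner_commute)
  then have "((\<lambda>y. y \<bullet> F y) has_derivative (\<lambda>v. 2 * (v \<bullet> F y))) (at y)"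
    using has_derivative_inner[OF has_derivative_ident
        bounded_linear_imp_has_derivative[OF F], of y UNIV] by simp
  from bounded_linear.has_derivative[OF bounded_linear_mult_right
      bounded_linear.has_derivative[OF bounded_linear_of_real this]]
  show ?thesis .
qed

text \<open>In a fixed direction \<open>v\<close> the derivative of the quadratic function is
  bounded linear in \<open>p\<close>, hence in every class \<open>Ck k S\<close>; one
  differentiation settles the exponent.\<close>

lemma smooth_on_exp_quadratic:
  fixes S :: "('b::real_normed_vector \<times> 'a) set" and c :: complex
  assumes "open S"
  shows "smooth_on S (\<lambda>p. exp (c * of_real (snd p \<bullet> F (snd p))))"
proof -
  have "Ck (Suc k) S (\<lambda>p. c * of_real (snd p \<bullet> F (snd p)))" for k
  proof (rule Ck_SucI[OF assms])
    show "((\<lambda>p. c * of_real (snd p \<bullet> F (snd p))) has_derivative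
        (\<lambda>v. c * of_real (2 * (snd v \<bullet> F (snd p))))) (at p)" for p :: "'b \<times> 'a"
      by (rule has_derivative_compose[OF has_derivative_snd[OF has_derivative_ident]
            quadratic_has_derivative])
    show "Ck k S (\<lambda>p. c * of_real (2 * (snd v \<bullet> F (snd p))))" for v :: "'b \<times> 'a"
      by (intro Ck_bounded_linear[OF assms]
          bounded_linear_compose[OF bounded_linear_mult_right]
          bounded_linear_compose[OF bounded_linear_of_real]
          bounded_linear_compose[OF bounded_linear_inner_right]
          bounded_linear_compose[OF F] bounded_linear_snd)
  qed
  then have "Ck k S (\<lambda>p. c * of_real (snd p \<bullet> F (snd p)))" for k
    by (rule Ck_Suc_imp_Ck)
  then show ?thesis
    unfolding smooth_on_def by (intro allI Ck_exp[OF assms])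
qed

text \<open>Charts change only the group component, so in every chart the exponential factor is
  given by the same formula.\<close>

lemma smooth_functions_mult_exp:
  fixes \<A> :: "('g::topological_space, 'a) atlas" and c :: complex
  assumes \<A>: "smooth_atlas \<A>" and \<phi>: "\<phi> \<in> smooth_functions \<A>"
  shows "(\<lambda>p. \<phi> p * exp (c * of_real (snd p \<bullet> F (snd p)))) \<in> smooth_functions \<A>"
proof -
  let ?E = "\<lambda>p. exp (c * of_real (snd p \<bullet> F (snd p)))"
  have "continuous_on UNIV \<phi>"
    using \<phi> unfolding smooth_functions_iff by blast
  then have cont: "continuous_on UNIV (\<lambda>p. \<phi> p * ?E p)"
    by (intro continuous_intros bounded_linear.continuous_on[OF F])
  have "smooth_on (map_prod W (\<lambda>y. y) ` (U \<times> UNIV))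
      (\<lambda>z. \<phi> (the_inv_into (U \<times> UNIV) (map_prod W (\<lambda>y. y)) z) *
        ?E (the_inv_into (U \<times> UNIV) (map_prod W (\<lambda>y. y)) z))"
    if chart: "(U, W) \<in> \<A>" for U W
  proof -
    let ?W = "map_prod W (\<lambda>y::'a. y)"
    let ?S = "?W ` (U \<times> UNIV)" and ?inv = "the_inv_into (U \<times> UNIV) ?W"
    have S: "?S = W ` U \<times> UNIV" by force
    have "open ?S"
      unfolding S using smooth_atlas_chart[OF \<A> chart] by (simp add: open_Times)
    have inj: "inj_on ?W (U \<times> UNIV)"
      using smooth_atlas_chart[OF \<A> chart] by (auto simp: inj_on_def)
    have "smooth_on ?S (\<lambda>z. \<phi> (?inv z))"
      using \<phi> chart unfolding smooth_functions_iff by blast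
    moreover have "snd z = snd (?inv z)" if z: "z \<in> ?S" for z
    proof -
      obtain q where q: "q \<in> U \<times> UNIV" "z = ?W q" using z by (rule imageE)
      show ?thesis unfolding q(2) the_inv_into_f_f[OF inj q(1)] by (simp add: map_prod_def split_beta)
    qed
    then have E_eq: "?E z = ?E (?inv z)" if "z \<in> ?S" for z
      using that by simp
    have "Ck k ?S (\<lambda>z. ?E (?inv z))" for k
    proof (rule Ck_cong[OF \<open>open ?S\<close>])
      show "?E z = ?E (?inv z)" if "z \<in> ?S" for z using that by (rule E_eq)
      show "Ck k ?S ?E"
        using smooth_on_exp_quadratic[OF \<open>open ?S\<close>] unfolding smooth_on_def by blast
    qed
    ultimately show ?thesis
      unfolding smooth_on_def using Ck_mult[OF \<open>open ?S\<close>] by blast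
  qed
  then show ?thesis
    using cont unfolding smooth_functions_iff by blast
qed

lemma tangent_derivative_mult_exp:
  fixes \<phi> :: "'g::{t2_space, second_countable_topology} \<times> 'a \<Rightarrow> complex"
  assumes G: "lie_group G \<A>" "exponential_map G \<A> Exp" and \<phi>: "\<phi> \<in> smooth_functions \<A>"
  shows "tangent_derivative G Exp (\<lambda>p. \<phi> p * exp (c * of_real (snd p \<bullet> F (snd p)))) (x, y) (U, V) =
    (tangent_derivative G Exp \<phi> (x, y) (U, V) + \<phi> (x, y) * (c * of_real (2 * (V \<bullet> F y)))) *
    exp (c * of_real (y \<bullet> F y))"
proof -
  interpret group G using G(1) by (simp add: lie_group_def)
  have "x \<in> carrier G" using G(1) by (simp add: lie_group_def)
  \<comment> \<open>At \<open>s = 0\<close> the curve passes through \<open>(x, y)\<close>, so the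
    undifferentiated factors of the product rule are values at that point.\<close>
  then have base: "(x \<otimes>\<^bsub>G\<^esub> Exp (0 *\<^sub>R U), y + 0 *\<^sub>R V) = (x, y)"
    by (simp add: exponential_map_0[OF G])
  let ?\<phi> = "\<lambda>s::real. \<phi> (x \<otimes>\<^bsub>G\<^esub> Exp (s *\<^sub>R U), y + s *\<^sub>R V)"
  let ?q = "\<lambda>s::real. c * of_real ((y + s *\<^sub>R V) \<bullet> F (y + s *\<^sub>R V))"
  have \<phi>': "(?\<phi> has_vector_derivative tangent_derivative G Exp \<phi> (x, y) (U, V)) (at 0)"
    using smooth_function_curve_differentiable[OF G \<phi>, of x U y V]
    by (simp add: tangent_derivative_def vector_derivative_works)
  have "((\<lambda>s. y + s *\<^sub>R V) has_derivative (\<lambda>s. s *\<^sub>R V)) (at (0::real))"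
    by (auto intro!: derivative_eq_intros)
  from has_derivative_compose[OF this quadratic_has_derivative]
  have "(?q has_vector_derivative c * of_real (2 * (V \<bullet> F y))) (at 0)"
    unfolding has_vector_derivative_def
    by (rule has_derivative_eq_rhs) (auto simp: scaleR_conv_of_real)
  then have "((exp \<circ> ?q) has_vector_derivative c * of_real (2 * (V \<bullet> F y)) * exp (?q 0)) (at 0)"
    by (rule field_vector_diff_chain_at) (rule DERIV_exp)
  from has_vector_derivative_mult[OF \<phi>' this] base show ?thesis
    unfolding tangent_derivative_def
    by (simp add: comp_def vector_derivative_at algebra_simps)
qed

text \<open>The constant is \<open>\<i> * \<sigma>\<close> times the 1/2 in the energy. The
  logarithmic derivative of the exponential along \<open>X\<close> cancels the connection
  term.\<close>

lemma covariant_derivative_mult_exp: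
  fixes \<phi> :: "'g::{t2_space, second_countable_topology} \<times> 'a \<Rightarrow> complex"
  assumes G: "lie_group G \<A>" "exponential_map G \<A> Exp" and \<phi>: "\<phi> \<in> smooth_functions \<A>"
    and X: "X \<in> conj_polarization (mixed_polarization F \<sigma>)"
  shows "covariant_derivative G Exp (\<lambda>p. \<phi> p * exp (\<i> * \<sigma> / 2 * of_real (snd p \<bullet> F (snd p)))) p X =
    ctangent_derivative G Exp \<phi> p X * exp (\<i> * \<sigma> / 2 * of_real (snd p \<bullet> F (snd p)))"
proof -
  obtain x y where p: "p = (x, y)" by (cases p)
  obtain A where A: "X = (cconj (cscale (- cnj \<sigma>) (cmap F A)), cconj A)"
    using X unfolding conj_polarization_def mixed_polarization_def by auto
  obtain U V where UV: "X = (U, V)" by (cases X)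
  have "F (- v) = - F v" for v using F by (simp add: linear_neg bounded_linear.linear)
  moreover have "v \<bullet> F y = y \<bullet> F v" for v
    using self_adjoint[of v y] by (simp add: inner_commute)
  \<comment> \<open>Conjugation turns \<open>- cnj \<sigma>\<close> into \<open>- \<sigma>\<close>,
    so \<open>U\<close> is \<open>- \<sigma>\<close> times the image of \<open>V\<close> under
    \<open>F\<close>; self-adjointness moves \<open>F\<close> onto \<open>y\<close>.\<close>
  ultimately have theta: "canonical_form p X =
      - \<sigma> * (of_real (rpart V \<bullet> F y) + \<i> * of_real (ipart V \<bullet> F y))"
    using A unfolding UV
    by (simp add: canonical_form_def p cconj_def cscale_def cmap_def cpair_def complex_eq_iff
        inner_diff_right inner_add_right algebra_simps)
  show ?thesis
    unfolding covariant_derivative_def theta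
    unfolding p UV ctangent_derivative_def prod.case tangent_derivative_mult_exp[OF G \<phi>] snd_conv
    by (simp add: algebra_simps)
qed

section \<open>Passage from polarized functions to polarized sections\<close>

lemma exp_lambda_fun:
  "exp (- \<i> * lambda_fun F \<sigma> p) = exp (\<i> * \<sigma> / 2 * of_real (snd p \<bullet> F (snd p)))"
  by (cases p) (simp add: lambda_fun_def energy_def mult.assoc)

text \<open>The energy is real, so only \<open>Im \<sigma>\<close> affects the modulus; squaring
  produces the factor 2 in \<open>kappa_fun\<close>.\<close>

lemma exp_kappa_fun: "exp (- kappa_fun F \<sigma> p) = (cmod (exp (- \<i> * lambda_fun F \<sigma> p)))\<^sup>2"
  by (cases p) (simp add: kappa_fun_def lambda_fun_def energy_def power2_eq_square flip: exp_add)

lemma polarized_sections_eq: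
  fixes G :: "'g::{t2_space, second_countable_topology} monoid"
  assumes G: "lie_group G \<A>" "exponential_map G \<A> Exp"
  shows "polarized_sections G \<A> Exp (mixed_polarization F \<sigma>) =
    (\<lambda>\<phi> p. \<phi> p * exp (- \<i> * lambda_fun F \<sigma> p)) `
      polarized_functions G \<A> Exp (mixed_polarization F \<sigma>)"
proof -
  have \<A>: "smooth_atlas \<A>" using G(1) by (simp add: lie_group_def)
  let ?E = "\<lambda>c p. exp (c * of_real (snd p \<bullet> F (snd p))) :: complex"
  define c where "c = \<i> * \<sigma> / 2"
  \<comment> \<open>The exponential never vanishes, so the covariant derivative of the product is
    zero exactly when the derivative of \<open>\<phi>\<close> is.\<close>
  have polarized: "(\<lambda>p. \<phi> p * ?E c p) \<in> polarized_sections G \<A> Exp (mixed_polarization F \<sigma>) \<longleftrightarrow>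
      \<phi> \<in> polarized_functions G \<A> Exp (mixed_polarization F \<sigma>)"
    if "\<phi> \<in> smooth_functions \<A>" for \<phi>
    using that smooth_functions_mult_exp[OF \<A> that]
    by (auto simp: polarized_sections_def polarized_functions_def
        covariant_derivative_mult_exp[OF G that, where \<sigma> = \<sigma>, folded c_def])
  \<comment> \<open>Surjectivity: the preimage of \<open>s\<close> is its quotient by the
    exponential, which is smooth because the constant may also be \<open>- c\<close>.\<close>
  have "\<exists>\<phi>\<in>polarized_functions G \<A> Exp (mixed_polarization F \<sigma>). s = (\<lambda>p. \<phi> p * ?E c p)"
    if s: "s \<in> polarized_sections G \<A> Exp (mixed_polarization F \<sigma>)" for s
  proof
    have s_eq: "(\<lambda>p. s p * ?E (- c) p * ?E c p) = s"
      by (simp add: mult.assoc flip: exp_add)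
    have smooth: "(\<lambda>p. s p * ?E (- c) p) \<in> smooth_functions \<A>"
      using s by (intro smooth_functions_mult_exp[OF \<A>]) (simp add: polarized_sections_def)
    show "(\<lambda>p. s p * ?E (- c) p) \<in> polarized_functions G \<A> Exp (mixed_polarization F \<sigma>)"
      using polarized[OF smooth] s unfolding s_eq by blast
    show "s = (\<lambda>p. s p * ?E (- c) p * ?E c p)" by (fact s_eq[symmetric])
  qed
  moreover have "\<phi> \<in> smooth_functions \<A>"
    if "\<phi> \<in> polarized_functions G \<A> Exp (mixed_polarization F \<sigma>)" for \<phi>
    using that by (simp add: polarized_functions_def)
  ultimately show ?thesis
    unfolding exp_lambda_fun c_def[symmetric] using polarized by blast
qed

end

section \<open>Equality of the two closures\<close>

theorem theorem4p3:
  fixes G :: "'g::{t2_space, second_countable_topology} monoid"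
    and \<A> :: "('g, 'a::real_inner) atlas"
    and Exp :: "'a \<Rightarrow> 'g"
    and H :: "'g set"
    and \<tt> :: "'a set"
    and n r :: nat
    and T :: "nat \<Rightarrow> 'a"
    and F :: "'a \<Rightarrow> 'a"
    and \<mu> :: "'g measure"
    and \<sigma> :: complex
  assumes "lie_group G \<A>"
    and "compact (UNIV :: 'g set)"
    and "connected (UNIV :: 'g set)"
    and "exponential_map G \<A> Exp"
    and "Ad_invariant_inner G Exp"
    and "maximal_torus G H"
    and "\<tt> = lie_algebra_of Exp H"
    and "n = dim (UNIV :: 'a set)"
    and "r = dim \<tt>"
    and "adapted_basis T n r \<tt>"
    and "haar_volume G \<A> Exp T n \<mu>"
    and "linear F"
    and "\<forall>u v. F u \<bullet> v = u \<bullet> F v"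
    and "range F \<subseteq> \<tt>"
    and "\<forall>u. (\<forall>v\<in>\<tt>. u \<bullet> v = 0) \<longrightarrow> F u = 0"
    and "\<forall>u\<in>\<tt>. u \<noteq> 0 \<longrightarrow> 0 < u \<bullet> F u"
    and "Im \<sigma> > 0"
  shows "quantum_space G \<A> Exp T n r F \<sigma> \<mu> =
    half_form_closure (half_form_measure T r F \<sigma> \<mu>)
      {(\<lambda>p. \<phi> p * exp (- \<i> * lambda_fun F \<sigma> p)) \<otimes>\<surd> Omega T n r F \<sigma> | \<phi>.
         \<phi> \<in> polarized_functions G \<A> Exp (mixed_polarization F \<sigma>) \<and>
         (\<integral>\<^sup>+ p. ennreal ((cmod (\<phi> p))\<^sup>2 * exp (- kappa_fun F \<sigma> p))
            \<partial>half_form_measure T r F \<sigma> \<mu>) < \<infinity>}"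
proof -
  have F: "bounded_linear F" "\<And>u v. F u \<bullet> v = u \<bullet> F v"
    using adapted_basis_bounded_linear[OF assms(10,12)] assms(13) by auto
  \<comment> \<open>The weighted integrand for \<open>\<phi>\<close> is the plain one for its
    section, so both integrability conditions coincide.\<close>
  have norm_eq: "(cmod (\<phi> p))\<^sup>2 * exp (- kappa_fun F \<sigma> p) =
      (cmod (\<phi> p * exp (- \<i> * lambda_fun F \<sigma> p)))\<^sup>2" for \<phi> p
    unfolding exp_kappa_fun[OF F] norm_mult power_mult_distrib ..
  show ?thesis
    \<comment> \<open>The generating sets are now equal, and so are their closures for the same
      measure.\<close>
    unfolding quantum_space_def polarized_sections_eq[OF F assms(1,4)] norm_eq
    by (intro arg_cong[where f = "half_form_closure _"]) blast
qed

end
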